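(* Let $P$ be the ordered bipartite graph with $U(P)=\{a_1<a_2<a_3\}$, $V(P)=\{b_1<b_2<b_3<b_4\}$ and edge set $\{a_1b_1,a_1b_3,a_2b_1,a_2b_4,a_3b_2,a_3b_4\}$ (the "sailboat graph"). Then $$ex_2(n,P)=n\,2^{O(\sqrt{\log n\,\log\log n})}.$$
   Context: An ordered bipartite graph is a tuple $G=(U,<_U,V,<_V,E)$ with $U,V$ disjoint linearly ordered vertex sets and $E\subseteq U\times V$. $G$ contains an ordered bipartite graph $P$ if there are injective order-preserving maps $U(P)\to U(G)$ and $V(P)\to V(G)$ that send edges of $P$ to edges of $G$; otherwise $G$ avoids $P$. For $P$ with at least one edge, $ex_2(n,P)$ is the maximum number of edges of an ordered bipartite graph $G$ with $|U(G)|=|V(G)|=n$ avoiding $P$. Logarithms are base 2. *)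

theory Defs
  imports Complex_Main "HOL-Library.Landau_Symbols"
begin

record 'a ordered_bigraph =
  U_of :: "'a set"
  less_U :: "'a rel"
  V_of :: "'a set"
  less_V :: "'a rel"
  edges :: "('a \<times> 'a) set"

definition ordered_bipartite_graph :: "'a ordered_bigraph \<Rightarrow> bool" where
  "ordered_bipartite_graph G \<longleftrightarrow>
     U_of G \<inter> V_of G = {} \<and>
     less_U G \<subseteq> U_of G \<times> U_of G \<and> strict_linear_order_on (U_of G) (less_U G) \<and>
     less_V G \<subseteq> V_of G \<times> V_of G \<and> strict_linear_order_on (V_of G) (less_V G) \<and>
     edges G \<subseteq> U_of G \<times> V_of G"

definition order_embedding :: "'a set \<Rightarrow> 'a rel \<Rightarrow> 'b set \<Rightarrow> 'b rel \<Rightarrow> ('a \<Rightarrow> 'b) \<Rightarrow> bool" where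
  "order_embedding A r B s f \<longleftrightarrow>
     f ` A \<subseteq> B \<and> inj_on f A \<and> (\<forall>x\<in>A. \<forall>y\<in>A. (x, y) \<in> r \<longrightarrow> (f x, f y) \<in> s)"

definition contains :: "'a ordered_bigraph \<Rightarrow> 'b ordered_bigraph \<Rightarrow> bool" where
  "contains G P \<longleftrightarrow>
     (\<exists>f g. order_embedding (U_of P) (less_U P) (U_of G) (less_U G) f \<and>
            order_embedding (V_of P) (less_V P) (V_of G) (less_V G) g \<and>
            (\<forall>(a, b) \<in> edges P. (f a, g b) \<in> edges G))"

abbreviation avoids :: "'a ordered_bigraph \<Rightarrow> 'b ordered_bigraph \<Rightarrow> bool" where
  "avoids G P \<equiv> \<not> contains G P"

text \<open>The host graphs have natural numbers as vertices, with arbitrary linear orders on the two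
  sides. This is no restriction: see \<open>ex2_upper\<close> below. The finiteness conditions matter
  only for \<open>n = 0\<close>, since infinite sets have cardinality \<open>0\<close>.\<close>

definition ex2 :: "nat \<Rightarrow> 'b ordered_bigraph \<Rightarrow> nat" where
  "ex2 n P = Max {card (edges G) | G :: nat ordered_bigraph.
     ordered_bipartite_graph G \<and> finite (U_of G) \<and> finite (V_of G) \<and>
     card (U_of G) = n \<and> card (V_of G) = n \<and> avoids G P}"

datatype sailboat_vertex = A1 | A2 | A3 | B1 | B2 | B3 | B4

definition sailboat :: "sailboat_vertex ordered_bigraph" where
  "sailboat =
     \<lparr> U_of = {A1, A2, A3},
       less_U = {(A1, A2), (A1, A3), (A2, A3)},
       V_of = {B1, B2, B3, B4},
       less_V = {(B1, B2), (B1, B3), (B1, B4), (B2, B3), (B2, B4), (B3, B4)},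
       edges = {(A1, B1), (A1, B3), (A2, B1), (A2, B4), (A3, B2), (A3, B4)} \<rparr>"

lemma ordered_bipartite_graph_sailboat: "ordered_bipartite_graph sailboat"
  unfolding ordered_bipartite_graph_def sailboat_def strict_linear_order_on_def
    trans_def irrefl_def total_on_def
  by auto

lemma card_edges_le:
  assumes "ordered_bipartite_graph G" "finite (U_of G)" "finite (V_of G)"
  shows "card (edges G) \<le> card (U_of G) * card (V_of G)"
proof -
  have "card (edges G) \<le> card (U_of G \<times> V_of G)"
    using assms by (intro card_mono) (auto simp: ordered_bipartite_graph_def)
  then show ?thesis by (simp add: card_cartesian_product)
qed

lemma finite_ex2_candidates:
  "finite {card (edges G) | G :: nat ordered_bigraph.
     ordered_bipartite_graph G \<and> finite (U_of G) \<and> finite (V_of G) \<and>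
     card (U_of G) = n \<and> card (V_of G) = n \<and> avoids G P}"
  by (rule finite_subset[of _ "{..n * n}"]) (auto dest: card_edges_le)

lemma strict_linear_order_on_map_prod:
  assumes "strict_linear_order_on A r" "r \<subseteq> A \<times> A" "inj_on h A"
  shows "strict_linear_order_on (h ` A) (map_prod h h ` r)"
proof -
  have "trans (map_prod h h ` r)"
  proof (rule transI)
    fix x y z assume "(x, y) \<in> map_prod h h ` r" "(y, z) \<in> map_prod h h ` r"
    then obtain a b c d where *: "(a, b) \<in> r" "(c, d) \<in> r" "x = h a" "y = h b" "y = h c" "z = h d"
      by auto
    then have "b = c" using assms(2,3) by (auto dest: inj_onD)
    with * have "(a, d) \<in> r" using assms(1) unfolding strict_linear_order_on_def
      by (auto dest: transD)
    with * show "(x, z) \<in> map_prod h h ` r" by force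
  qed
  moreover have "irrefl (map_prod h h ` r)"
  proof (rule irreflI, rule notI)
    fix x assume "(x, x) \<in> map_prod h h ` r"
    then obtain a b where *: "(a, b) \<in> r" "x = h a" "x = h b" by auto
    then have "a = b" using assms(2,3) by (auto dest: inj_onD)
    with * show False using assms(1) by (auto simp: strict_linear_order_on_def irrefl_def)
  qed
  moreover have "total_on (h ` A) (map_prod h h ` r)"
    using assms(1) unfolding strict_linear_order_on_def total_on_def by (force simp: image_iff)
  ultimately show ?thesis by (simp add: strict_linear_order_on_def)
qed

lemma order_embedding_inv_into:
  assumes emb: "order_embedding A r (h ` B) (map_prod h h ` s) f"
    and s: "s \<subseteq> B \<times> B" and B: "B \<subseteq> C" and h: "inj_on h C"
  shows "order_embedding A r B s (inv_into C h \<circ> f)"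
proof -
  have inv: "inv_into C h (h b) = b" if "b \<in> B" for b
    using that B h by (auto intro: inv_into_f_f)
  have im: "f ` A \<subseteq> h ` B" and inj: "inj_on f A"
    and mono: "\<And>x y. x \<in> A \<Longrightarrow> y \<in> A \<Longrightarrow> (x, y) \<in> r \<Longrightarrow> (f x, f y) \<in> map_prod h h ` s"
    using emb by (auto simp: order_embedding_def)
  have "inj_on (inv_into C h) (f ` A)"
    using im B by (intro inj_on_inv_into) blast
  then have "inj_on (inv_into C h \<circ> f) A"
    using inj by (rule comp_inj_on[rotated])
  moreover have "(inv_into C h \<circ> f) ` A \<subseteq> B"
    using im inv by (fastforce simp: image_subset_iff)
  moreover have "((inv_into C h \<circ> f) x, (inv_into C h \<circ> f) y) \<in> s"
    if "x \<in> A" "y \<in> A" "(x, y) \<in> r" for x y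
  proof -
    from mono[OF that] obtain c d where *: "(c, d) \<in> s" "f x = h c" "f y = h d" by auto
    with s have "c \<in> B" "d \<in> B" by auto
    with * show ?thesis by (simp add: inv)
  qed
  ultimately show ?thesis by (simp add: order_embedding_def)
qed

lemma ex2_upper:
  fixes G :: "'a ordered_bigraph"
  assumes G: "ordered_bipartite_graph G" and fin: "finite (U_of G)" "finite (V_of G)"
    and card: "card (U_of G) = n" "card (V_of G) = n"
    and av: "avoids G P"
  shows "card (edges G) \<le> ex2 n P"
proof -
  let ?C = "U_of G \<union> V_of G"
  obtain h :: "'a \<Rightarrow> nat" where h: "inj_on h ?C"
    using finite_imp_inj_to_nat_seg[of ?C] fin by auto
  define H where "H = \<lparr> U_of = h ` U_of G, less_U = map_prod h h ` less_U G,
    V_of = h ` V_of G, less_V = map_prod h h ` less_V G, edges = map_prod h h ` edges G \<rparr>"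
  have hU: "inj_on h (U_of G)" and hV: "inj_on h (V_of G)"
    using h by (auto intro: inj_on_subset)
  have sub: "less_U G \<subseteq> U_of G \<times> U_of G" "less_V G \<subseteq> V_of G \<times> V_of G"
    "edges G \<subseteq> U_of G \<times> V_of G" "U_of G \<inter> V_of G = {}"
    and ord: "strict_linear_order_on (U_of G) (less_U G)" "strict_linear_order_on (V_of G) (less_V G)"
    using G by (auto simp: ordered_bipartite_graph_def)
  have "h ` U_of G \<inter> h ` V_of G = h ` (U_of G \<inter> V_of G)"
    using h by (intro inj_on_image_Int[symmetric]) auto
  then have "ordered_bipartite_graph H"
    using sub strict_linear_order_on_map_prod[OF ord(1) sub(1) hU]
      strict_linear_order_on_map_prod[OF ord(2) sub(2) hV]
    unfolding ordered_bipartite_graph_def H_def by (simp; fast)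
  moreover have "avoids H P"
  proof
    assume "contains H P"
    then obtain f g where
      f: "order_embedding (U_of P) (less_U P) (h ` U_of G) (map_prod h h ` less_U G) f" and
      g: "order_embedding (V_of P) (less_V P) (h ` V_of G) (map_prod h h ` less_V G) g" and
      e: "\<And>a b. (a, b) \<in> edges P \<Longrightarrow> (f a, g b) \<in> map_prod h h ` edges G"
      unfolding contains_def H_def by (simp del: map_prod_imageI) fast
    have "(inv_into ?C h (f a), inv_into ?C h (g b)) \<in> edges G" if ab: "(a, b) \<in> edges P" for a b
    proof -
      from e[OF ab] obtain c d where *: "(c, d) \<in> edges G" "f a = h c" "g b = h d" by auto
      with sub(3) have "c \<in> ?C" "d \<in> ?C" by auto
      with * show ?thesis by (simp add: inv_into_f_f[OF h])
    qed
    then have "contains G P"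
      using order_embedding_inv_into[OF f sub(1) _ h] order_embedding_inv_into[OF g sub(2) _ h]
      unfolding contains_def
      by (intro exI[of _ "inv_into ?C h \<circ> f"] exI[of _ "inv_into ?C h \<circ> g"]) auto
    with av show False by simp
  qed
  moreover have "card (edges H) = card (edges G)"
  proof -
    have "inj_on (map_prod h h) (U_of G \<times> V_of G)"
      using hU hV by (rule map_prod_inj_on)
    then have "inj_on (map_prod h h) (edges G)"
      using sub(3) by (rule inj_on_subset)
    then show ?thesis by (simp add: H_def card_image)
  qed
  ultimately have "card (edges G) \<in> {card (edges G) | G :: nat ordered_bigraph.
     ordered_bipartite_graph G \<and> finite (U_of G) \<and> finite (V_of G) \<and>
     card (U_of G) = n \<and> card (V_of G) = n \<and> avoids G P}"
    using fin card hU hV by (intro CollectI exI[of _ H]) (simp add: H_def card_image)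
  then show ?thesis
    unfolding ex2_def by (rule Max_ge[OF finite_ex2_candidates])
qed

lemma ex2_attained:
  assumes "edges P \<noteq> {}"
  shows "\<exists>G :: nat ordered_bigraph. ordered_bipartite_graph G \<and> finite (U_of G) \<and> finite (V_of G) \<and>
     card (U_of G) = n \<and> card (V_of G) = n \<and> avoids G P \<and> card (edges G) = ex2 n P"
proof -
  let ?S = "{card (edges G) | G :: nat ordered_bigraph.
     ordered_bipartite_graph G \<and> finite (U_of G) \<and> finite (V_of G) \<and>
     card (U_of G) = n \<and> card (V_of G) = n \<and> avoids G P}"
  let ?G = "\<lparr> U_of = {..<n}, less_U = {(x, y). x < y \<and> y < n},
    V_of = {n..<2 * n}, less_V = {(x, y). n \<le> x \<and> x < y \<and> y < 2 * n}, edges = {} \<rparr>"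
  have "ordered_bipartite_graph ?G"
    unfolding ordered_bipartite_graph_def strict_linear_order_on_def trans_def irrefl_def total_on_def
    by auto
  moreover have "avoids ?G P"
    using assms by (auto simp: contains_def)
  ultimately have "card (edges ?G) \<in> ?S"
    by (intro CollectI exI[of _ ?G]) simp
  then have "?S \<noteq> {}" by blast
  then have "Max ?S \<in> ?S"
    by (rule Max_in[OF finite_ex2_candidates])
  then show ?thesis
    unfolding ex2_def[symmetric] by auto
qed

end

theory Submission imports Defs begin

text \<open>Cut the columns into \<open>K\<close> consecutive blocks. For every column \<open>b\<close> and every block \<open>B\<close>,
  delete the first and the last edge in column \<open>b\<close> whose row meets \<open>B\<close>; this costs at most \<open>2 K\<close>
  edges per column. If some row \<open>a\<^sub>2\<close> still met four blocks \<open>B\<^sub>1 < B\<^sub>2 < B\<^sub>3 < B\<^sub>4\<close>, say in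
  columns \<open>b\<^sub>1 \<in> B\<^sub>1\<close> and \<open>b\<^sub>4 \<in> B\<^sub>4\<close>, then the deleted edges would provide an earlier row
  \<open>a\<^sub>1\<close> meeting \<open>b\<^sub>1\<close> and \<open>B\<^sub>3\<close> and a later row \<open>a\<^sub>3\<close> meeting \<open>b\<^sub>4\<close> and \<open>B\<^sub>2\<close>, a sailboat.
  So every row meets at most three blocks, and recursion inside the blocks gives at most
  \<open>2 K D m + 3\<^sup>D n\<close> edges for \<open>n\<close> rows and \<open>m \<le> K\<^sup>D\<close> columns. The choice \<open>K = 2\<^sup>D\<close> with
  \<open>D\<close> about \<open>sqrt (log n)\<close> yields \<open>n 2\<^bsup>O(sqrt (log n))\<^esup>\<close>.\<close>

section \<open>Edge bound for sailboat-free sets of index pairs (row, column)\<close>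

definition sailboat_free :: "(nat \<times> nat) set \<Rightarrow> bool" where
  "sailboat_free E \<longleftrightarrow>
     (\<nexists>a1 a2 a3 b1 b2 b3 b4. a1 < a2 \<and> a2 < a3 \<and> b1 < b2 \<and> b2 < b3 \<and> b3 < b4 \<and>
        (a1, b1) \<in> E \<and> (a1, b3) \<in> E \<and> (a2, b1) \<in> E \<and> (a2, b4) \<in> E \<and>
        (a3, b2) \<in> E \<and> (a3, b4) \<in> E)"

lemma sailboat_free_subset: "sailboat_free E \<Longrightarrow> F \<subseteq> E \<Longrightarrow> sailboat_free F"
  unfolding sailboat_free_def by blast

lemma four_elements:
  fixes S :: "nat set"
  assumes "card S > 3"
  obtains w x y z where "w \<in> S" "x \<in> S" "y \<in> S" "z \<in> S" "w < x" "x < y" "y < z"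
proof -
  have fin: "finite S" "S \<noteq> {}" using assms by (auto intro: card_ge_0_finite)
  let ?T = "S - {Min S, Max S}"
  have "card ?T \<ge> card S - card {Min S, Max S}"
    by (rule diff_card_le_card_Diff) simp
  moreover have "card {Min S, Max S} \<le> 2" by (simp add: card_insert_if)
  ultimately have "card ?T \<ge> 2" using assms by linarith
  then obtain W where "W \<subseteq> ?T" "card W = 2"
    by (rule obtain_subset_with_card_n)
  then obtain u v where "u \<in> ?T" "v \<in> ?T" "u \<noteq> v"
    by (auto simp: card_2_iff)
  then obtain x y where xy: "x \<in> ?T" "y \<in> ?T" "x < y"
    by (cases u v rule: linorder_cases) auto
  have "Min S < x" "y < Max S"
    using xy fin by (auto simp: less_le)
  then show thesis
    using that[of "Min S" x y "Max S"] xy fin by simp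
qed

text \<open>Double counting of the pairs \<open>(g x, f x)\<close> with \<open>x \<in> A\<close>.
  With \<open>g\<close> the block index of an edge, a sum over blocks becomes a sum over columns
  (\<open>f = snd\<close>) or over rows (\<open>f = fst\<close>).\<close>

lemma sum_card_image_fibres:
  assumes "finite A" "finite I" "g ` A \<subseteq> I"
  shows "(\<Sum>i\<in>I. card (f ` {x \<in> A. g x = i})) = (\<Sum>y\<in>f ` A. card (g ` {x \<in> A. f x = y}))"
proof -
  have "(\<Sum>i\<in>I. card (f ` {x \<in> A. g x = i})) = card (SIGMA i:I. f ` {x \<in> A. g x = i})"
    using assms by (subst card_SigmaI) auto
  also have "\<dots> = card (prod.swap ` (SIGMA i:I. f ` {x \<in> A. g x = i}))"
    by (rule card_image[symmetric]) simp
  also have "prod.swap ` (SIGMA i:I. f ` {x \<in> A. g x = i}) =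
      (SIGMA y:f ` A. g ` {x \<in> A. f x = y})"
    using assms(3) by (force simp: image_iff)
  also have "card \<dots> = (\<Sum>y\<in>f ` A. card (g ` {x \<in> A. f x = y}))"
    using assms by (subst card_SigmaI) auto
  finally show ?thesis .
qed

text \<open>Induction on \<open>D\<close>. The \<open>div\<close> hypothesis puts all columns into
  one aligned window of length \<open>K ^ D\<close>; \<open>q\<close> varies so that the claim
  applies to every sub-block. Projections charge only rows and columns that carry an edge.\<close>

lemma sailboat_free_card_le:
  assumes "finite E" "sailboat_free E" "\<And>a b. (a, b) \<in> E \<Longrightarrow> b div K ^ D = q" "K \<ge> 1"
  shows "card E \<le> 2 * K * D * card (snd ` E) + 3 ^ D * card (fst ` E)"
  using assms(1-3)
proof (induction D arbitrary: E q)
  case 0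
  \<comment> \<open>As \<open>K ^ 0 = 1\<close>, the window is the single column \<open>q\<close>,
    so each row has at most one edge.\<close>
  then have "snd e = q" if "e \<in> E" for e using that by (cases e) auto
  then have "inj_on fst E" by (metis inj_onI prod_eqI)
  then show ?case by (simp add: card_image)
next
  case (Suc D)
  \<comment> \<open>\<open>\<beta> b\<close> is the index of the block of length
    \<open>K ^ D\<close> containing \<open>b\<close>; \<open>Bs\<close> indexes the \<open>K\<close>
    blocks of window \<open>q\<close>.\<close>
  define \<beta> where "\<beta> b = b div K ^ D" for b
  define Bs where "Bs = {q * K..<q * K + K}"
  define R where "R b B = {a. (a, b) \<in> E \<and> (\<exists>b'. (a, b') \<in> E \<and> \<beta> b' = B)}" for b B
  \<comment> \<open>For empty \<open>R b B\<close> the pair is arbitrary. This is harmless: the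
    count uses only the size of \<open>T m\<close> and
    \<open>E \<subseteq> E' \<union> T Min \<union> T Max\<close>.\<close>
  define T where "T m = (\<lambda>(b, B). (m (R b B), b)) ` (snd ` E \<times> Bs)" for m :: "nat set \<Rightarrow> nat"
  define E' where "E' = E - T Min - T Max"
  have fin: "finite E" "finite E'" "finite Bs" using Suc.prems by (auto simp: E'_def Bs_def)
  have \<beta>: "\<beta> b \<in> Bs" if "(a, b) \<in> E" for a b
  proof -
    have "\<beta> b div K = q"
      using Suc.prems(3)[OF that] by (simp only: \<beta>_def power_Suc2 div_mult2_eq)
    then have "\<beta> b = q * K + \<beta> b mod K" by (metis div_mult_mod_eq)
    moreover have "\<beta> b mod K < K" using assms(4) by simp
    ultimately show ?thesis unfolding Bs_def by simp
  qed
  have finR: "finite (R b B)" for b B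
    by (rule finite_subset[of _ "fst ` E"]) (force simp: R_def fin)+
  have cardT: "card (T m) \<le> K * card (snd ` E)" for m
  proof -
    have "card (T m) \<le> card (snd ` E \<times> Bs)"
      unfolding T_def using fin by (intro card_image_le) simp
    then show ?thesis by (simp add: card_cartesian_product Bs_def mult.commute)
  qed
  \<comment> \<open>The row of a surviving edge lies in \<open>R b B\<close> but is neither its
    minimum nor its maximum, so these two rows are the witnesses.\<close>
  have above: "\<exists>a'<a. (a', b) \<in> E \<and> (\<exists>b'. (a', b') \<in> E \<and> \<beta> b' = B)"
    and below: "\<exists>a'>a. (a', b) \<in> E \<and> (\<exists>b'. (a', b') \<in> E \<and> \<beta> b' = B)"
    if ab: "(a, b) \<in> E'" and ac: "(a, c) \<in> E" "\<beta> c = B" for a b c B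
  proof -
    have aR: "a \<in> R b B" using ab ac by (auto simp: R_def E'_def)
    have "(m (R b B), b) \<in> T m" for m
      using ab \<beta>[OF ac(1)] ac(2) by (force simp: T_def E'_def)
    then have "a \<noteq> Min (R b B)" "a \<noteq> Max (R b B)" using ab by (auto simp: E'_def)
    then have "Min (R b B) < a" "a < Max (R b B)"
      using Min_le[OF finR aR] Max_ge[OF finR aR] by auto
    moreover have "Min (R b B) \<in> R b B" "Max (R b B) \<in> R b B"
      using finR[of b B] aR by (auto intro!: Min_in Max_in)
    ultimately show "\<exists>a'<a. (a', b) \<in> E \<and> (\<exists>b'. (a', b') \<in> E \<and> \<beta> b' = B)"
      "\<exists>a'>a. (a', b) \<in> E \<and> (\<exists>b'. (a', b') \<in> E \<and> \<beta> b' = B)"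
      unfolding R_def by blast+
  qed
  have \<beta>_less: "b < c" if "\<beta> b < \<beta> c" for b c
    using that div_le_mono[of c b "K ^ D"] by (force simp: \<beta>_def not_le[symmetric])
  have three: "card ((\<beta> \<circ> snd) ` {e \<in> E'. fst e = a}) \<le> 3" for a
  proof (rule ccontr)
    assume "\<not> ?thesis"
    then have "card ((\<beta> \<circ> snd) ` {e \<in> E'. fst e = a}) > 3" by simp
    then obtain w x y z where "w \<in> (\<beta> \<circ> snd) ` {e \<in> E'. fst e = a}"
      "x \<in> (\<beta> \<circ> snd) ` {e \<in> E'. fst e = a}" "y \<in> (\<beta> \<circ> snd) ` {e \<in> E'. fst e = a}"
      "z \<in> (\<beta> \<circ> snd) ` {e \<in> E'. fst e = a}" and less: "w < x" "x < y" "y < z"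
      by (rule four_elements)
    then obtain bw bx bv bz where e: "(a, bw) \<in> E'" "(a, bx) \<in> E'" "(a, bv) \<in> E'" "(a, bz) \<in> E'"
      and b: "\<beta> bw = w" "\<beta> bx = x" "\<beta> bv = y" "\<beta> bz = z"
      by auto
    have eE: "(a, bw) \<in> E" "(a, bx) \<in> E" "(a, bv) \<in> E" "(a, bz) \<in> E"
      using e by (auto simp: E'_def)
    \<comment> \<open>\<open>b3\<close> and \<open>b2\<close> come with the new rows and may differ
      from \<open>bv\<close> and \<open>bx\<close>. Their blocks alone fix the order of the
      columns.\<close>
    obtain a1 b3 where a1: "a1 < a" "(a1, bw) \<in> E" "(a1, b3) \<in> E" "\<beta> b3 = y"
      using above[OF e(1) eE(3) b(3)] by blast
    obtain a3 b2 where a3: "a3 > a" "(a3, bz) \<in> E" "(a3, b2) \<in> E" "\<beta> b2 = x"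
      using below[OF e(4) eE(2) b(2)] by blast
    have "bw < b2" "b2 < b3" "b3 < bz" using less b a1 a3 by (auto intro: \<beta>_less)
    with a1 a3 eE Suc.prems(2) show False unfolding sailboat_free_def by blast
  qed
  let ?F = "\<lambda>B. {e \<in> E'. (\<beta> \<circ> snd) e = B}"
  have img: "(\<beta> \<circ> snd) ` E' \<subseteq> Bs" using \<beta> by (force simp: E'_def)
  have "card E' = (\<Sum>B\<in>Bs. card (?F B))"
    using sum.group[OF fin(2,3) img, of "\<lambda>_. 1 :: nat"] by simp
  also have "\<dots> \<le> (\<Sum>B\<in>Bs. 2 * K * D * card (snd ` ?F B) + 3 ^ D * card (fst ` ?F B))"
  proof (rule sum_mono)
    fix B
    show "card (?F B) \<le> 2 * K * D * card (snd ` ?F B) + 3 ^ D * card (fst ` ?F B)"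
      using fin by (intro Suc.IH[of _ B] sailboat_free_subset[OF Suc.prems(2)])
        (auto simp: E'_def \<beta>_def)
  qed
  also have "\<dots> = 2 * K * D * (\<Sum>B\<in>Bs. card (snd ` ?F B)) + 3 ^ D * (\<Sum>B\<in>Bs. card (fst ` ?F B))"
    by (simp only: sum.distrib sum_distrib_left)
  \<comment> \<open>Each column lies in a single block, so the column counts do not grow.\<close>
  also have "(\<Sum>B\<in>Bs. card (snd ` ?F B)) = (\<Sum>b\<in>snd ` E'. card ((\<beta> \<circ> snd) ` {e \<in> E'. snd e = b}))"
    by (rule sum_card_image_fibres[OF fin(2,3) img])
  also have "\<dots> \<le> (\<Sum>b\<in>snd ` E'. 1)"
  proof (rule sum_mono)
    fix b
    have "(\<beta> \<circ> snd) ` {e \<in> E'. snd e = b} \<subseteq> {\<beta> b}" by auto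
    then show "card ((\<beta> \<circ> snd) ` {e \<in> E'. snd e = b}) \<le> 1"
      using card_mono[of "{\<beta> b}"] by fastforce
  qed
  also have "(\<Sum>b\<in>snd ` E'. 1) \<le> card (snd ` E)"
    using fin by (auto simp: E'_def intro!: card_mono)
  \<comment> \<open>Each row is counted at most three times, which turns \<open>3 ^ D\<close> into
    \<open>3 ^ Suc D\<close>.\<close>
  also have "(\<Sum>B\<in>Bs. card (fst ` ?F B)) = (\<Sum>a\<in>fst ` E'. card ((\<beta> \<circ> snd) ` {e \<in> E'. fst e = a}))"
    by (rule sum_card_image_fibres[OF fin(2,3) img])
  also have "\<dots> \<le> (\<Sum>a\<in>fst ` E'. 3)" by (rule sum_mono) (rule three)
  also have "\<dots> \<le> 3 * card (fst ` E)"
    using fin by (auto simp: E'_def intro!: card_mono)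
  finally have E': "card E' \<le> 2 * K * D * card (snd ` E) + 3 ^ D * (3 * card (fst ` E))"
    by simp
  \<comment> \<open>The deleted edges, at most \<open>2 * K\<close> per column, account for the step
    from \<open>D\<close> to \<open>Suc D\<close> in the first term.\<close>
  have "card E \<le> card (E' \<union> (T Min \<union> T Max))"
    using fin by (intro card_mono) (auto simp: E'_def T_def)
  also have "\<dots> \<le> card E' + (card (T Min) + card (T Max))"
    by (meson add_left_mono card_Un_le order_trans)
  also have "\<dots> \<le> card E' + 2 * K * card (snd ` E)"
    using cardT[of Min] cardT[of Max] by simp
  finally show ?case using E' by (simp add: algebra_simps)
qed

section \<open>Transfer to ordered bipartite graphs through vertex ranks\<close>

lemma finite_strict_linear_order_rank:
  assumes "finite A" "strict_linear_order_on A r" "r \<subseteq> A \<times> A"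
  obtains h :: "'a \<Rightarrow> nat" where "inj_on h A" "h ` A \<subseteq> {..<card A}"
    "\<And>x y. x \<in> A \<Longrightarrow> y \<in> A \<Longrightarrow> h x < h y \<Longrightarrow> (x, y) \<in> r"
proof -
  \<comment> \<open>The rank is the number of predecessors. Reflecting \<open><\<close> into
    \<open>r\<close> is what later pulls a sailboat among ranks back into the graph.\<close>
  define h where "h x = card {y \<in> A. (y, x) \<in> r}" for x
  have tr: "trans r" and ir: "irrefl r" and tot: "total_on A r"
    using assms(2) by (auto simp: strict_linear_order_on_def)
  have mono: "h x < h y" if "(x, y) \<in> r" for x y
    unfolding h_def using that assms(1,3) tr ir
    by (intro psubset_card_mono) (auto dest: transD simp: irrefl_def)
  have total: "x = y \<or> (x, y) \<in> r \<or> (y, x) \<in> r" if "x \<in> A" "y \<in> A" for x y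
    using tot that by (auto simp: total_on_def)
  have "inj_on h A"
    using mono total by (metis inj_onI less_irrefl)
  moreover have "h ` A \<subseteq> {..<card A}"
  proof safe
    fix x assume "x \<in> A"
    then have "{y \<in> A. (y, x) \<in> r} \<subset> A" using ir by (auto simp: irrefl_def)
    then show "h x < card A" unfolding h_def by (rule psubset_card_mono[OF assms(1)])
  qed
  moreover have "(x, y) \<in> r" if "x \<in> A" "y \<in> A" "h x < h y" for x y
    using mono total that by (metis less_asym less_irrefl)
  ultimately show thesis by (rule that)
qed

lemma ex2_sailboat_le:
  assumes "K \<ge> 1" "n \<le> K ^ D"
  shows "ex2 n sailboat \<le> n * (2 * K * D + 3 ^ D)"
proof -
  have "edges sailboat \<noteq> {}" by (simp add: sailboat_def)
  then obtain G :: "nat ordered_bigraph" where G: "ordered_bipartite_graph G"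
    and fin: "finite (U_of G)" "finite (V_of G)" and card: "card (U_of G) = n" "card (V_of G) = n"
    and av: "avoids G sailboat" and ex: "card (edges G) = ex2 n sailboat"
    using ex2_attained by blast
  have ord: "strict_linear_order_on (U_of G) (less_U G)" "less_U G \<subseteq> U_of G \<times> U_of G"
    "strict_linear_order_on (V_of G) (less_V G)" "less_V G \<subseteq> V_of G \<times> V_of G"
    and sub: "edges G \<subseteq> U_of G \<times> V_of G"
    using G by (auto simp: ordered_bipartite_graph_def)
  obtain h :: "nat \<Rightarrow> nat" where h: "inj_on h (U_of G)" "h ` U_of G \<subseteq> {..<n}"
    "\<And>x y. x \<in> U_of G \<Longrightarrow> y \<in> U_of G \<Longrightarrow> h x < h y \<Longrightarrow> (x, y) \<in> less_U G"
    using finite_strict_linear_order_rank[OF fin(1) ord(1,2)] card by metis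
  obtain k :: "nat \<Rightarrow> nat" where k: "inj_on k (V_of G)" "k ` V_of G \<subseteq> {..<n}"
    "\<And>x y. x \<in> V_of G \<Longrightarrow> y \<in> V_of G \<Longrightarrow> k x < k y \<Longrightarrow> (x, y) \<in> less_V G"
    using finite_strict_linear_order_rank[OF fin(2) ord(3,4)] card by metis
  define E where "E = map_prod h k ` edges G"
  have EE: "\<exists>u v. u \<in> U_of G \<and> v \<in> V_of G \<and> a = h u \<and> b = k v \<and> (u, v) \<in> edges G"
    if "(a, b) \<in> E" for a b
    using that sub by (auto simp: E_def)
  have hk: "(u, v) \<in> edges G" if "(h u, k v) \<in> E" "u \<in> U_of G" "v \<in> V_of G" for u v
    using EE[OF that(1)] that(2,3) h(1) k(1) by (metis inj_onD)
  have "sailboat_free E"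
    unfolding sailboat_free_def
  proof (rule notI, elim exE conjE)
    fix a1 a2 a3 b1 b2 b3 b4
    assume less: "a1 < a2" "a2 < a3" "b1 < b2" "b2 < b3" "b3 < b4"
      and e: "(a1, b1) \<in> E" "(a1, b3) \<in> E" "(a2, b1) \<in> E" "(a2, b4) \<in> E" "(a3, b2) \<in> E" "(a3, b4) \<in> E"
    obtain u1 u2 u3 v1 v2 v3 v4 where
      u: "u1 \<in> U_of G" "u2 \<in> U_of G" "u3 \<in> U_of G" "a1 = h u1" "a2 = h u2" "a3 = h u3" and
      v: "v1 \<in> V_of G" "v2 \<in> V_of G" "v3 \<in> V_of G" "v4 \<in> V_of G"
        "b1 = k v1" "b2 = k v2" "b3 = k v3" "b4 = k v4"
      using EE[OF e(1)] EE[OF e(2)] EE[OF e(3)] EE[OF e(5)] EE[OF e(6)] by metis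
    define f where "f x = (case x of A1 \<Rightarrow> u1 | A2 \<Rightarrow> u2 | _ \<Rightarrow> u3)" for x
    define g where "g x = (case x of B1 \<Rightarrow> v1 | B2 \<Rightarrow> v2 | B3 \<Rightarrow> v3 | _ \<Rightarrow> v4)" for x
    have "order_embedding (U_of sailboat) (less_U sailboat) (U_of G) (less_U G) f"
      using u less by (auto simp: order_embedding_def sailboat_def f_def intro!: h(3))
    moreover have "order_embedding (V_of sailboat) (less_V sailboat) (V_of G) (less_V G) g"
      using v less by (auto simp: order_embedding_def sailboat_def g_def intro!: k(3))
    moreover have "\<forall>(a, b) \<in> edges sailboat. (f a, g b) \<in> edges G"
      using u v e by (auto simp: sailboat_def f_def g_def intro!: hk)
    ultimately show False using av unfolding contains_def by blast
  qed
  moreover have finE: "finite E"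
    unfolding E_def using sub fin by (intro finite_imageI) (auto intro: finite_subset)
  \<comment> \<open>Column ranks are below \<open>n \<le> K ^ D\<close>, so the whole graph lies in
    the window \<open>q = 0\<close>.\<close>
  moreover have "b div K ^ D = 0" if "(a, b) \<in> E" for a b
    using EE[OF that] k(2) assms(2) by (intro div_less) fastforce
  ultimately have "card E \<le> 2 * K * D * card (snd ` E) + 3 ^ D * card (fst ` E)"
    using assms(1) by (intro sailboat_free_card_le)
  also have "card (snd ` E) \<le> card {..<n}"
    by (intro card_mono) (use EE k(2) in fastforce)+
  also have "card (fst ` E) \<le> card {..<n}"
    by (intro card_mono) (use EE h(2) in fastforce)+
  finally have "card E \<le> n * (2 * K * D + 3 ^ D)" by (simp add: algebra_simps)
  moreover have "card E = card (edges G)"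
    unfolding E_def using inj_on_subset[OF map_prod_inj_on[OF h(1) k(1)] sub] by (rule card_image)
  ultimately show ?thesis using ex by simp
qed

text \<open>A star whose edges share one column avoids the sailboat, which needs four columns. For
  \<open>n > 0\<close> this makes the ratio \<open>ex2 n sailboat / n\<close> at least 1, so its
  logarithm is meaningful and nonnegative.\<close>

lemma ex2_sailboat_ge: "n \<le> ex2 n sailboat"
proof (cases "n = 0")
  case False
  let ?G = "\<lparr> U_of = {..<n}, less_U = {(x, y). x < y \<and> y < n},
    V_of = {n..<2 * n}, less_V = {(x, y). n \<le> x \<and> x < y \<and> y < 2 * n}, edges = {..<n} \<times> {n} \<rparr>"
  have "ordered_bipartite_graph ?G"
    unfolding ordered_bipartite_graph_def strict_linear_order_on_def trans_def irrefl_def total_on_def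
    using False by auto
  moreover have "avoids ?G sailboat"
    by (auto simp: contains_def sailboat_def order_embedding_def)
  ultimately have "card (edges ?G) \<le> ex2 n sailboat"
    by (intro ex2_upper) auto
  then show ?thesis by (simp add: card_cartesian_product)
qed simp

section \<open>Choice of parameters and asymptotics\<close>

lemma log_ex2_sailboat_le:
  assumes "n \<ge> 2"
  shows "log 2 (real (ex2 n sailboat) / real n) \<le> 6 * sqrt (log 2 (real n))"
proof -
  define s where "s = sqrt (log 2 (real n))"
  have log: "log 2 (real n) \<ge> 1" using assms by simp
  then have s: "s \<ge> 1" by (simp add: s_def)
  \<comment> \<open>With \<open>K = 2 ^ t\<close> and \<open>D = t\<close>, the condition
    \<open>n \<le> K ^ D\<close> reads \<open>log 2 n \<le> t * t\<close>.\<close>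
  define t where "t = nat \<lceil>s\<rceil>"
  have t: "s \<le> real t" "real t \<le> s + 1" unfolding t_def using s by linarith+
  have "log 2 (real n) = s ^ 2" using log by (simp add: s_def)
  also have "\<dots> \<le> real t ^ 2" using t s by (intro power_mono) auto
  finally have "log 2 (real n) \<le> real (t * t)" by (simp add: power2_eq_square)
  then have "real n \<le> 2 powr real (t * t)" using assms by (simp add: log_le_iff)
  also have "\<dots> = real ((2 ^ t) ^ t)" by (simp add: powr_realpow power_mult[symmetric] flip: of_nat_mult)
  finally have "n \<le> (2 ^ t) ^ t" by (simp only: of_nat_le_iff)
  then have "ex2 n sailboat \<le> n * (2 * 2 ^ t * t + 3 ^ t)"
    by (intro ex2_sailboat_le) auto
  also have "\<dots> \<le> n * 4 ^ Suc t"
  proof -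
    \<comment> \<open>By \<open>t \<le> 2 ^ t\<close> the first term is at most
      \<open>2 * 4 ^ t\<close>; the second is at most \<open>4 ^ t\<close>.\<close>
    have "2 ^ t * t \<le> 2 ^ t * (2 ^ t :: nat)" by (simp add: less_imp_le)
    also have "\<dots> = 4 ^ t" by (simp flip: power_mult_distrib)
    finally have "2 * 2 ^ t * t + 3 ^ t \<le> (4 :: nat) ^ Suc t"
      using power_mono[of 3 "4 :: nat" t] by simp
    then show ?thesis by (rule mult_le_mono2)
  qed
  finally have "real (ex2 n sailboat) \<le> real (n * 4 ^ Suc t)" by (simp only: of_nat_le_iff)
  then have "real (ex2 n sailboat) / real n \<le> 4 ^ Suc t"
    using assms by (simp add: field_simps)
  also have "\<dots> = 2 powr real (2 * Suc t)"
    by (subst powr_realpow) (simp_all add: power_mult)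
  finally have "log 2 (real (ex2 n sailboat) / real n) \<le> real (2 * Suc t)"
    using assms ex2_sailboat_ge[of n] by (subst log_le_iff) auto
  \<comment> \<open>\<open>2 * (t + 1) \<le> 2 * s + 4 \<le> 6 * s\<close>, using
    \<open>s \<ge> 1\<close>.\<close>
  also have "\<dots> \<le> 6 * s" using t s by simp
  finally show ?thesis by (simp only: s_def)
qed

theorem theorem4p1:
  "\<exists>g \<in> O(\<lambda>n. sqrt (log 2 (real n) * log 2 (log 2 (real n)))).
     \<forall>n. real (ex2 n sailboat) = real n * 2 powr g n"
proof
  let ?g = "\<lambda>n. log 2 (real (ex2 n sailboat) / real n)"
  show "\<forall>n. real (ex2 n sailboat) = real n * 2 powr ?g n"
  proof
    fix n
    show "real (ex2 n sailboat) = real n * 2 powr ?g n"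
      \<comment> \<open>For \<open>n = 0\<close> the upper bound with \<open>K = 1\<close>,
        \<open>D = 0\<close> gives \<open>ex2 0 sailboat = 0\<close>; for \<open>n > 0\<close> the
        ratio is positive.\<close>
      using ex2_sailboat_ge[of n] ex2_sailboat_le[of 1 n 0] by (cases "n = 0") auto
  qed
  show "?g \<in> O(\<lambda>n. sqrt (log 2 (real n) * log 2 (log 2 (real n))))"
  proof (rule bigoI[of _ 6])
    \<comment> \<open>From \<open>n = 4\<close> on, the iterated logarithm is at least 1, so
      multiplying by it only weakens the bound \<open>6 * sqrt (log 2 n)\<close>.\<close>
    have "norm (?g n) \<le> 6 * norm (sqrt (log 2 (real n) * log 2 (log 2 (real n))))"
      if n: "n \<ge> 4" for n
    proof -
      have log: "log 2 (real n) \<ge> 2" using n by (subst le_log_iff) auto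
      then have "log 2 (log 2 (real n)) \<ge> 1" by simp
      then have "log 2 (real n) * 1 \<le> log 2 (real n) * log 2 (log 2 (real n))"
        using log by (intro mult_left_mono) auto
      then have "6 * sqrt (log 2 (real n)) \<le> 6 * norm (sqrt (log 2 (real n) * log 2 (log 2 (real n))))"
        using real_sqrt_le_mono[of "log 2 (real n)" "log 2 (real n) * log 2 (log 2 (real n))"]
        unfolding real_norm_def by linarith
      moreover have "norm (?g n) = ?g n" using ex2_sailboat_ge[of n] n by simp
      ultimately show ?thesis
        using log_ex2_sailboat_le[of n] n by linarith
    qed
    then show "\<forall>\<^sub>F n in sequentially. norm (?g n) \<le> 6 * norm (sqrt (log 2 (real n) * log 2 (log 2 (real n))))"
      by (rule eventually_sequentiallyI)
  qed
qed

end
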